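(* Let $p\ge2$ be an integer and suppose $k\ge\lambda(p-1)+2$. Let $A$ be a (zero-diagonal) representative of an $\mathrm{SBIBD}(v,k,\lambda)$. If $A$ contains a pairwise separated set $F$ of size $p$, then the columns of $A$ can be relabeled to obtain a zero-diagonal representative $A'$ in which $F$ admits a private target permutation. Consequently, $$q^*(A',p)=\lambda(p-1)+2.$$
   Context: Symmetric design. For integers $1\le\lambda<k<v$, an $\mathrm{SBIBD}(v,k,\lambda)$ consists of $v$ points and $v$ blocks such that every block contains $k$ points, every point lies in $k$ blocks, and every two distinct points lie together in exactly $\lambda$ blocks. After independently labeling points and blocks by $0,1,\dots,v-1$, the incidence matrix $A=(A_{ij})\in\{0,1\}^{v\times v}$, with $A_{ij}=1$ iff point $i$ lies in block $j$, is called a representative of the SBIBD. It is zero-diagonal if $A_{ii}=0$ for all $i$. Relabeling the columns of $A$ means replacing $A$ by $A'$ with $A'_{h\ell}=A_{h,\pi(\ell)}$ for a permutation $\pi$ of $\{0,\dots,v-1\}$, the row labels being kept fixed. Pairwise separated set. For a representative $A$, $F\subseteq\{0,\dots,v-1\}$ and $t\in\{0,\dots,v-1\}$ let $d_F(t)=\sum_{i\in F}A_{it}$ (computed with respect to the representative under consideration). The set $F$ is pairwise separated if $d_F(t)\le2$ for every $t$. Private target permutation. For a node $i$ let $\mathcal S_{\mathrm{tgt}}(i)=\{j:A_{ij}=1\}$ (again with respect to the representative under consideration). A pairwise separated set $F$ with $|F|=p$ admits a private target permutation if there is a permutation $\sigma:F\to F$ such that $\sigma(i)\in\mathcal S_{\mathrm{tgt}}(i)$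 and $d_F(\sigma(i))=1$ for every $i\in F$. Coding model, for a zero-diagonal representative $A$. There are $v$ nodes $0,\dots,v-1$; let $\mathcal S_{\mathrm{tgt}}(i)=\{j:A_{ij}=1\}$ (admissible targets) and $\mathcal S_{\mathrm{src}}(j)=\{i:A_{ij}=1\}$ (sources); both have size $k$. There is a finite collection of data objects, each a binary word of one common positive length; $\oplus$ is componentwise addition over $\mathbb F_2$. Each object $x$ has exactly one primary copy, stored at its primary node $i$, and for the replica count $q\in\{0,\dots,k\}$ it selects a set $T_x\subseteq\mathcal S_{\mathrm{tgt}}(i)$ of exactly $q$ distinct target nodes (chosen separately for each object) and sends one replica to each node in $T_x$. A placement is legal if at each node $j$ the replicas received at $j$ are partitioned into $k$-tuples, each containing exactly one replica from every primary node in $\mathcal S_{\mathrm{src}}(j)$ (the partition is part of the placement). For each such tuple, consisting of objects $x_1,\dots,x_k$, node $j$ stores one parity $x_1\oplus\cdots\oplus x_k$; the replicas are then discarded. Failures and recovery. Given a set of failed nodes, all primary copies and parities stored at failed nodes are lost, and those stored at other nodes are alive. A placement permits recovery from that failure set if the values of all objects whose primary node is failed are uniquely determined by the alive primary copies and the alive parities (the placement being known). Universal replica threshold. For a zero-diagonal representative $A$ and an integer $p\ge1$, $q^*(A,p)$ is the smallest integer $q\in\{0,1,\dots,k\}$ such that every legal placement of any finite object collection using exactly $q$ target nodes per object permits recovery from every set of at most $p$ failed nodes. *)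

theory Defs
  imports
    "HOL-Library.Z2"
    "HOL-Library.Disjoint_Sets"
    "HOL-Combinatorics.Permutations"
begin

section \<open>Symmetric designs and their representatives\<close>

definition sbibd :: "'p set \<Rightarrow> 'b set \<Rightarrow> ('p \<Rightarrow> 'b \<Rightarrow> bool) \<Rightarrow> nat \<Rightarrow> nat \<Rightarrow> nat \<Rightarrow> bool" where
  "sbibd P B inc v k lam \<longleftrightarrow>
     1 \<le> lam \<and> lam < k \<and> k < v \<and>
     finite P \<and> card P = v \<and> finite B \<and> card B = v \<and>
     (\<forall>b\<in>B. card {x \<in> P. inc x b} = k) \<and>
     (\<forall>x\<in>P. card {b \<in> B. inc x b} = k) \<and>
     (\<forall>x\<in>P. \<forall>y\<in>P. x \<noteq> y \<longrightarrow> card {b \<in> B. inc x b \<and> inc y b} = lam)"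

text \<open>A \<open>v \<times> v\<close> matrix is a function of two natural numbers; only the entries with both
  indices below \<open>v\<close> are ever used.\<close>

definition representative ::
    "'p set \<Rightarrow> 'b set \<Rightarrow> ('p \<Rightarrow> 'b \<Rightarrow> bool) \<Rightarrow> nat \<Rightarrow> (nat \<Rightarrow> nat \<Rightarrow> nat) \<Rightarrow> bool" where
  "representative P B inc v A \<longleftrightarrow>
     (\<exists>pt bl. bij_betw pt {..<v} P \<and> bij_betw bl {..<v} B \<and>
        (\<forall>i<v. \<forall>j<v. A i j = (if inc (pt i) (bl j) then 1 else 0)))"

definition zero_diagonal :: "nat \<Rightarrow> (nat \<Rightarrow> nat \<Rightarrow> nat) \<Rightarrow> bool" where
  "zero_diagonal v A \<longleftrightarrow> (\<forall>i<v. A i i = 0)"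

definition relabel_columns :: "(nat \<Rightarrow> nat) \<Rightarrow> (nat \<Rightarrow> nat \<Rightarrow> nat) \<Rightarrow> nat \<Rightarrow> nat \<Rightarrow> nat" where
  "relabel_columns \<pi> A = (\<lambda>h l. A h (\<pi> l))"

definition tgt :: "nat \<Rightarrow> (nat \<Rightarrow> nat \<Rightarrow> nat) \<Rightarrow> nat \<Rightarrow> nat set" where
  "tgt v A i = {j. j < v \<and> A i j = 1}"

definition src :: "nat \<Rightarrow> (nat \<Rightarrow> nat \<Rightarrow> nat) \<Rightarrow> nat \<Rightarrow> nat set" where
  "src v A j = {i. i < v \<and> A i j = 1}"

definition col_count :: "(nat \<Rightarrow> nat \<Rightarrow> nat) \<Rightarrow> nat set \<Rightarrow> nat \<Rightarrow> nat" where
  "col_count A F t = (\<Sum>i\<in>F. A i t)"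

definition pairwise_separated :: "nat \<Rightarrow> (nat \<Rightarrow> nat \<Rightarrow> nat) \<Rightarrow> nat set \<Rightarrow> bool" where
  "pairwise_separated v A F \<longleftrightarrow> F \<subseteq> {..<v} \<and> (\<forall>t<v. col_count A F t \<le> 2)"

definition admits_private_target_permutation ::
    "nat \<Rightarrow> (nat \<Rightarrow> nat \<Rightarrow> nat) \<Rightarrow> nat set \<Rightarrow> bool" where
  "admits_private_target_permutation v A F \<longleftrightarrow>
     pairwise_separated v A F \<and>
     (\<exists>\<sigma>. \<sigma> permutes F \<and> (\<forall>i\<in>F. \<sigma> i \<in> tgt v A i \<and> col_count A F (\<sigma> i) = 1))"


section \<open>Placements\<close>

text \<open>Objects are named by natural numbers. A replica received at a node is identified with
  the object it copies: the targets of an object are distinct, so no node receives two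
  replicas of the same object. Hence a tuple of replicas at a node is a set of objects.\<close>

record placement =
  word_length :: nat
  objects :: "nat set"
  primary :: "nat \<Rightarrow> nat"
  targets :: "nat \<Rightarrow> nat set"
  tuples :: "nat \<Rightarrow> nat set set"

definition received :: "placement \<Rightarrow> nat \<Rightarrow> nat set" where
  "received D j = {x \<in> objects D. j \<in> targets D x}"

definition legal_placement ::
    "nat \<Rightarrow> nat \<Rightarrow> (nat \<Rightarrow> nat \<Rightarrow> nat) \<Rightarrow> nat \<Rightarrow> placement \<Rightarrow> bool" where
  "legal_placement v k A q D \<longleftrightarrow>
     word_length D > 0 \<and> finite (objects D) \<and>
     (\<forall>x\<in>objects D. primary D x < v \<and>
        targets D x \<subseteq> tgt v A (primary D x) \<and> card (targets D x) = q) \<and>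
     (\<forall>j<v. partition_on (received D j) (tuples D j) \<and>
        (\<forall>U\<in>tuples D j. card U = k \<and> (\<forall>i\<in>src v A j. \<exists>!x. x \<in> U \<and> primary D x = i)))"


section \<open>Recovery and the universal replica threshold\<close>

definition parity :: "nat \<Rightarrow> (nat \<Rightarrow> bit list) \<Rightarrow> nat set \<Rightarrow> bit list" where
  "parity n w U = map (\<lambda>c. \<Sum>x\<in>U. w x ! c) [0..<n]"

definition valuation :: "placement \<Rightarrow> (nat \<Rightarrow> bit list) \<Rightarrow> bool" where
  "valuation D w \<longleftrightarrow> (\<forall>x\<in>objects D. length (w x) = word_length D)"

text \<open>Unique determination: any two assignments of words to the objects that produce the
  same alive primary copies and the same alive parities agree on the lost objects.\<close>

definition permits_recovery :: "nat \<Rightarrow> placement \<Rightarrow> nat set \<Rightarrow> bool" where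
  "permits_recovery v D failed \<longleftrightarrow>
     (\<forall>w w'. valuation D w \<and> valuation D w' \<and>
        (\<forall>x\<in>objects D. primary D x \<notin> failed \<longrightarrow> w x = w' x) \<and>
        (\<forall>j<v. j \<notin> failed \<longrightarrow>
           (\<forall>U\<in>tuples D j. parity (word_length D) w U = parity (word_length D) w' U))
        \<longrightarrow> (\<forall>x\<in>objects D. primary D x \<in> failed \<longrightarrow> w x = w' x))"

definition universally_recoverable ::
    "nat \<Rightarrow> nat \<Rightarrow> (nat \<Rightarrow> nat \<Rightarrow> nat) \<Rightarrow> nat \<Rightarrow> nat \<Rightarrow> bool" where
  "universally_recoverable v k A p q \<longleftrightarrow>
     (\<forall>D failed. legal_placement v k A q D \<and> failed \<subseteq> {..<v} \<and> card failed \<le> p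
        \<longrightarrow> permits_recovery v D failed)"

text \<open>If no \<open>q \<le> k\<close> qualifies, the value below is an unspecified number, about which no
  equation with a concrete value is provable.\<close>

definition replica_threshold :: "nat \<Rightarrow> nat \<Rightarrow> (nat \<Rightarrow> nat \<Rightarrow> nat) \<Rightarrow> nat \<Rightarrow> nat" where
  "replica_threshold v k A p = (LEAST q. q \<le> k \<and> universally_recoverable v k A p q)"

end

theory Submission
  imports Defs "HOL-Library.Nat_Bijection" "HOL-Analysis.Convex"
begin

text \<open>
  Relabeling: every \<open>i \<in> F\<close> has a column \<open>c i\<close> that meets \<open>F\<close> only in row \<open>i\<close>. Put \<open>c i\<close> at the
  label \<open>\<sigma> i\<close> for a fixpoint-free permutation \<open>\<sigma>\<close> of \<open>F\<close>, and complete the labeling along a perfect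
  matching in the zero entries of the remaining rows and columns. A violation of Hall's condition
  would be an all-ones submatrix on \<open>S \<times> W\<close> with \<open>|S| + |W| > v - p\<close>, while the variance of the
  column counts of \<open>S\<close> forces \<open>|S| |W| (k - lam - 1) \<le> lam (v - |S| - |W|)\<close>.

  Upper bound: if two valuations differ on lost objects with primary nodes \<open>Y \<subseteq> X\<close>, where \<open>X\<close> is the
  set of failed nodes, then each target of such an object is failed or meets \<open>Y\<close> at least twice.
  Summing over \<open>Y\<close> gives \<open>q |Y| \<le> lam |Y| (|Y| - 1) + p\<close>, whence \<open>q \<le> lam (p - 1) + 1\<close>.

  Lower bound: take one object for each node \<open>i\<close> and each \<open>q\<close>-set of targets of \<open>i\<close>. With \<open>F\<close> failed,
  flip all objects of \<open>i \<in> F\<close> whose targets lie among the \<open>lam (p - 1)\<close> columns that \<open>i\<close> shares with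
  another element of \<open>F\<close> and the failed node \<open>\<sigma> i\<close>. At a shared column both members of \<open>F\<close> send
  equally many flipped replicas, so the tuples can pair them and no alive parity changes.
\<close>

section \<open>Finite combinatorics\<close>

text \<open>Induction on \<open>I\<close>. A tight proper subset \<open>J\<close> is matched first,
  and the rest is matched into what the neighbourhood of \<open>J\<close> leaves over. If no subset
  is tight, an arbitrary first choice leaves enough room.\<close>

lemma hall_distinct_representatives:
  fixes N :: "'i \<Rightarrow> 'b set"
  assumes "finite I" and "\<And>i. i \<in> I \<Longrightarrow> finite (N i)"
    and "\<And>J. J \<subseteq> I \<Longrightarrow> card J \<le> card (\<Union>(N ` J))"
  shows "\<exists>f. inj_on f I \<and> (\<forall>i\<in>I. f i \<in> N i)"
  using assms
proof (induction I arbitrary: N rule: finite_psubset_induct)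
  case (psubset I)
  have finI: "finite J" if "J \<subseteq> I" for J
    using that psubset.hyps finite_subset by blast
  show ?case
  proof (cases "\<exists>J. J \<subset> I \<and> J \<noteq> {} \<and> card (\<Union>(N ` J)) = card J")
    case True
    then obtain J where J: "J \<subset> I" "J \<noteq> {}" "card (\<Union>(N ` J)) = card J"
      by blast
    obtain f where f: "inj_on f J" "\<forall>i\<in>J. f i \<in> N i"
      using psubset.IH[OF J(1), of N] psubset.prems J(1)
      by (metis psubset_imp_subset subset_trans subsetD)
    define N' where "N' = (\<lambda>i. N i - \<Union>(N ` J))"
    \<comment> \<open>Hall's condition for \<open>K \<union> J\<close>, minus the equality for the
      tight set \<open>J\<close>, leaves the condition for \<open>K\<close> in the reduced
      neighbourhoods.\<close>
    have "card K \<le> card (\<Union>(N' ` K))" if K: "K \<subseteq> I - J" for K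
    proof -
      have "card K + card J = card (K \<union> J)"
        using K J finI by (subst card_Un_disjoint) auto
      also have "\<dots> \<le> card (\<Union>(N ` (K \<union> J)))"
        using K J by (intro psubset.prems) auto
      also have "\<Union>(N ` (K \<union> J)) = \<Union>(N' ` K) \<union> \<Union>(N ` J)"
        by (auto simp: N'_def)
      also have "card \<dots> \<le> card (\<Union>(N' ` K)) + card (\<Union>(N ` J))"
        by (rule card_Un_le)
      finally show ?thesis using J by simp
    qed
    moreover have "I - J \<subset> I" using J by auto
    moreover have "finite (N' i)" if "i \<in> I - J" for i
      using that psubset.prems(1) by (auto simp: N'_def)
    ultimately obtain g where g: "inj_on g (I - J)" "\<forall>i\<in>I - J. g i \<in> N' i"
      using psubset.IH[of "I - J" N'] by blast
    define h where "h = (\<lambda>i. if i \<in> J then f i else g i)"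
    have "inj_on h I"
      unfolding inj_on_def
    proof (intro ballI impI)
      fix a b assume ab: "a \<in> I" "b \<in> I" "h a = h b"
      show "a = b"
      proof (cases "a \<in> J \<longleftrightarrow> b \<in> J")
        case True
        then show ?thesis
          using ab f(1) g(1) by (auto simp: h_def inj_on_def split: if_splits)
      next
        case False
        have "h c \<in> \<Union>(N ` J) \<longleftrightarrow> c \<in> J" if "c \<in> I" for c
          using that f(2) g(2) by (auto simp: h_def N'_def)
        then show ?thesis using False ab by metis
      qed
    qed
    moreover have "\<forall>i\<in>I. h i \<in> N i"
      using f g by (auto simp: h_def N'_def)
    ultimately show ?thesis by blast
  next
    case no_tight: False
    show ?thesis
    proof (cases "I = {}")
      case True
      then show ?thesis by simp
    next
      case nonempty: False
      then obtain i where i: "i \<in> I" by blast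
      have "card {i} \<le> card (N i)"
        using psubset.prems(2)[of "{i}"] i by simp
      then have "N i \<noteq> {}" by auto
      then obtain x where x: "x \<in> N i" by blast
      define N' where "N' = (\<lambda>j. N j - {x})"
      \<comment> \<open>Without tight sets every nonempty \<open>K\<close> has a neighbour to spare,
        so the loss of \<open>x\<close> is harmless.\<close>
      have "card K \<le> card (\<Union>(N' ` K))" if K: "K \<subseteq> I - {i}" for K
      proof (cases "K = {}")
        case False
        have "K \<subset> I" using K i by auto
        then have "card (\<Union>(N ` K)) \<noteq> card K"
          using no_tight False by metis
        moreover have "card K \<le> card (\<Union>(N ` K))"
          using K by (intro psubset.prems) auto
        ultimately have "card K \<le> card (\<Union>(N ` K)) - 1"
          by linarith
        also have "\<dots> \<le> card (\<Union>(N ` K) - {x})"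
          by (simp add: card_Diff_singleton_if)
        also have "\<Union>(N ` K) - {x} = \<Union>(N' ` K)"
          by (auto simp: N'_def)
        finally show ?thesis .
      qed simp
      moreover have "I - {i} \<subset> I" using i by auto
      moreover have "finite (N' j)" if "j \<in> I - {i}" for j
        using that psubset.prems(1) by (auto simp: N'_def)
      ultimately obtain g where g: "inj_on g (I - {i})" "\<forall>j\<in>I - {i}. g j \<in> N' j"
        using psubset.IH[of "I - {i}" N'] by blast
      have "inj_on (g(i := x)) I"
        using g by (auto simp: inj_on_def N'_def)
      moreover have "\<forall>j\<in>I. (g(i := x)) j \<in> N j"
        using g x by (auto simp: N'_def)
      ultimately show ?thesis by blast
    qed
  qed
qed

text \<open>The cyclic shift along an enumeration of \<open>F\<close> moves every element as soon as
  there are two.\<close>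

lemma ex_fixpoint_free_permutation:
  assumes "finite F" and "card F \<ge> 2"
  shows "\<exists>\<sigma>. \<sigma> permutes F \<and> (\<forall>i\<in>F. \<sigma> i \<noteq> i)"
proof -
  define n where "n = card F"
  obtain e where e: "bij_betw e {0..<n} F"
    using ex_bij_betw_nat_finite[OF assms(1)] n_def by blast
  define g where "g m = (if Suc m = n then 0 else Suc m)" for m
  have n2: "n \<ge> 2" using assms n_def by simp
  have g: "bij_betw g {0..<n} {0..<n}"
    unfolding bij_betw_def
  proof
    show inj: "inj_on g {0..<n}" by (auto simp: g_def inj_on_def split: if_splits)
    show "g ` {0..<n} = {0..<n}"
      by (rule endo_inj_surj[OF _ _ inj]) (use n2 in \<open>auto simp: g_def\<close>)
  qed
  define r where "r = e \<circ> g \<circ> inv_into {0..<n} e"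
  have r: "bij_betw r F F"
    unfolding r_def
    by (intro bij_betw_trans[OF bij_betw_inv_into[OF e]] bij_betw_trans[OF g] e)
  define \<sigma> where "\<sigma> i = (if i \<in> F then r i else i)" for i
  have "bij_betw \<sigma> F F"
    using r by (rule bij_betw_cong[THEN iffD1, rotated]) (simp add: \<sigma>_def)
  then have "\<sigma> permutes F"
    by (rule bij_imp_permutes) (simp add: \<sigma>_def)
  moreover have "\<sigma> i \<noteq> i" if "i \<in> F" for i
  proof -
    obtain m where m: "m < n" "i = e m"
      using e \<open>i \<in> F\<close> by (auto simp: bij_betw_def)
    have "inv_into {0..<n} e i = m"
      using e m by (simp add: bij_betw_def inv_into_f_f)
    then have "\<sigma> i = e (g m)" using that by (simp add: \<sigma>_def r_def)
    moreover have "g m \<noteq> m" "g m < n" using m n2 by (auto simp: g_def)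
    ultimately show ?thesis
      using e m by (auto simp: bij_betw_def inj_on_def)
  qed
  ultimately show ?thesis by blast
qed

text \<open>Serves to number the replicas of one source with a distinguished subset first.
  Distinguished subsets of equal size then end at the same number for all sources.\<close>

lemma ex_bij_betw_initial_segment:
  assumes "finite Y" and "X \<subseteq> Y"
  shows "\<exists>h. bij_betw h Y {..<card Y} \<and> (\<forall>y\<in>Y. h y < card X \<longleftrightarrow> y \<in> X)"
proof -
  have fX: "finite X" using assms finite_subset by blast
  have le: "card X \<le> card Y" using assms by (rule card_mono)
  obtain f where f: "bij_betw f X {..<card X}"
    using fX by (metis atLeast0LessThan ex_bij_betw_finite_nat)
  have "card (Y - X) = card {card X..<card Y}"
    using assms fX by (simp add: card_Diff_subset)
  then obtain g where g: "bij_betw g (Y - X) {card X..<card Y}"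
    using assms by (metis finite_Diff finite_atLeastLessThan finite_same_card_bij)
  define h where "h y = (if y \<in> X then f y else g y)" for y
  have hX: "bij_betw h X {..<card X}"
    using f by (rule bij_betw_cong[THEN iffD1, rotated]) (simp add: h_def)
  have hY: "bij_betw h (Y - X) {card X..<card Y}"
    using g by (rule bij_betw_cong[THEN iffD1, rotated]) (simp add: h_def)
  have "bij_betw h (X \<union> (Y - X)) ({..<card X} \<union> {card X..<card Y})"
    by (rule bij_betw_combine[OF hX hY]) auto
  moreover have "X \<union> (Y - X) = Y" "{..<card X} \<union> {card X..<card Y} = {..<card Y}"
    using assms le by auto
  moreover have "h y < card X \<longleftrightarrow> y \<in> X" if "y \<in> Y" for y
  proof (cases "y \<in> X")
    case True
    then show ?thesis using hX by (auto simp: bij_betw_def)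
  next
    case False
    then have "h y \<in> {card X..<card Y}" using hY that by (blast dest: bij_betwE)
    then show ?thesis using False by simp
  qed
  ultimately show ?thesis by metis
qed

text \<open>The sets avoiding \<open>j\<close> are removed from all \<open>q\<close>-subsets. The
  difference of binomials is also right at \<open>q = 0\<close>, where a formula with
  \<open>q - 1\<close> would go wrong in \<open>nat\<close>.\<close>

lemma card_subsets_containing:
  assumes "finite S" and "j \<in> S"
  shows "card {T. T \<subseteq> S \<and> j \<in> T \<and> card T = q} = (card S choose q) - ((card S - 1) choose q)"
proof -
  have "{T. T \<subseteq> S \<and> j \<in> T \<and> card T = q}
      = {T. T \<subseteq> S \<and> card T = q} - {T. T \<subseteq> S - {j} \<and> card T = q}"
    by auto
  moreover have "card ({T. T \<subseteq> S \<and> card T = q} - {T. T \<subseteq> S - {j} \<and> card T = q})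
      = (card S choose q) - (card (S - {j}) choose q)"
    using assms n_subsets[of S q] n_subsets[of "S - {j}" q]
    by (subst card_Diff_subset) auto
  ultimately show ?thesis using assms by simp
qed

section \<open>Incidence matrices of symmetric designs\<close>

text \<open>The entrywise form of \<open>A A^T = (k - lam) I + lam J\<close> for a 0/1 matrix,
  together with the column sums; points and blocks have disappeared.\<close>

locale design_matrix =
  fixes v k lam :: nat and A :: "nat \<Rightarrow> nat \<Rightarrow> nat"
  assumes lam_pos: "1 \<le> lam" and lam_less: "lam < k" and k_less: "k < v"
    and entry: "\<And>i j. i < v \<Longrightarrow> j < v \<Longrightarrow> A i j = 0 \<or> A i j = 1"
    and row_inner: "\<And>i i'. i < v \<Longrightarrow> i' < v \<Longrightarrow>
      (\<Sum>t<v. A i t * A i' t) = (if i = i' then k else lam)"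
    and column_sum: "\<And>t. t < v \<Longrightarrow> (\<Sum>i<v. A i t) = k"
begin

section \<open>Double counting with row and column sums\<close>

lemma entry_idem: "i < v \<Longrightarrow> j < v \<Longrightarrow> A i j * A i j = A i j"
  using entry[of i j] by auto

lemma row_sum: "i < v \<Longrightarrow> (\<Sum>t<v. A i t) = k"
  using row_inner[of i i] by (simp add: entry_idem)

lemma sum_entries_card:
  assumes "i < v"
  shows "(\<Sum>t<v. A i t * of_bool (Q t)) = card {t. t < v \<and> A i t = 1 \<and> Q t}"
proof -
  have "(\<Sum>t<v. A i t * of_bool (Q t)) = (\<Sum>t<v. if A i t = 1 \<and> Q t then 1 else 0)"
    using entry[OF assms] by (intro sum.cong) fastforce+
  also have "\<dots> = card {t. t < v \<and> A i t = 1 \<and> Q t}"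
    by (subst sum.If_cases) (auto intro!: arg_cong[where f = card])
  finally show ?thesis .
qed

lemma card_tgt: "i < v \<Longrightarrow> card (tgt v A i) = k"
  using sum_entries_card[of i "\<lambda>_. True"] by (simp add: row_sum tgt_def)

lemma col_count_card:
  assumes "X \<subseteq> {..<v}" and "t < v"
  shows "col_count A X t = card (X \<inter> src v A t)"
proof -
  have "finite X" using assms finite_subset by blast
  have "col_count A X t = (\<Sum>i\<in>X. if A i t = 1 then 1 else 0)"
    unfolding col_count_def using entry assms by (intro sum.cong) fastforce+
  also have "\<dots> = card (X \<inter> {i. A i t = 1})"
    using \<open>finite X\<close> by (simp add: sum.If_cases)
  also have "X \<inter> {i. A i t = 1} = X \<inter> src v A t"
    using assms by (auto simp: src_def)
  finally show ?thesis .
qed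

lemma col_count_all: "t < v \<Longrightarrow> col_count A {..<v} t = k"
  by (simp add: col_count_def column_sum)

lemma card_src: "t < v \<Longrightarrow> card (src v A t) = k"
proof -
  assume t: "t < v"
  have "{..<v} \<inter> src v A t = src v A t" by (auto simp: src_def)
  then show ?thesis using col_count_card[of "{..<v}" t] col_count_all t by simp
qed

lemma sum_col_count:
  assumes "X \<subseteq> {..<v}"
  shows "(\<Sum>t<v. col_count A X t) = card X * k"
proof -
  have "(\<Sum>t<v. col_count A X t) = (\<Sum>i\<in>X. \<Sum>t<v. A i t)"
    unfolding col_count_def by (rule sum.swap)
  also have "\<dots> = (\<Sum>i\<in>X. k)"
    using assms by (intro sum.cong row_sum) auto
  finally show ?thesis by simp
qed

lemma sum_entry_col_count:
  assumes "X \<subseteq> {..<v}" and "i \<in> X"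
  shows "(\<Sum>t<v. A i t * col_count A X t) = k + (card X - 1) * lam"
proof -
  have fin: "finite X" using assms finite_subset by blast
  have "(\<Sum>t<v. A i t * col_count A X t) = (\<Sum>i'\<in>X. \<Sum>t<v. A i t * A i' t)"
    unfolding col_count_def sum_distrib_left by (rule sum.swap)
  also have "\<dots> = (\<Sum>i'\<in>X. if i = i' then k else lam)"
    using assms by (intro sum.cong row_inner) auto
  also have "\<dots> = k + (\<Sum>i'\<in>X - {i}. if i = i' then k else lam)"
    using assms fin by (subst sum.remove) auto
  also have "(\<Sum>i'\<in>X - {i}. if i = i' then k else lam) = (\<Sum>i'\<in>X - {i}. lam)"
    by (intro sum.cong) auto
  finally show ?thesis using assms fin by simp
qed

lemma sum_col_count_squared:
  assumes "X \<subseteq> {..<v}"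
  shows "(\<Sum>t<v. (col_count A X t)\<^sup>2) = card X * (k + (card X - 1) * lam)"
proof -
  have "(\<Sum>t<v. (col_count A X t)\<^sup>2) = (\<Sum>t<v. \<Sum>i\<in>X. A i t * col_count A X t)"
    unfolding power2_eq_square by (simp add: col_count_def sum_distrib_right)
  also have "\<dots> = (\<Sum>i\<in>X. \<Sum>t<v. A i t * col_count A X t)"
    by (rule sum.swap)
  also have "\<dots> = (\<Sum>i\<in>X. k + (card X - 1) * lam)"
    using assms by (intro sum.cong sum_entry_col_count) auto
  finally show ?thesis by simp
qed

text \<open>The second moment of the column counts, taken over all rows: each count is
  \<open>k\<close>, so both sides are multiplied by \<open>v\<close>.\<close>

lemma order_identity: "k * k = k + (v - 1) * lam"
proof -
  have "v * (k * k) = (\<Sum>t<v. (col_count A {..<v} t)\<^sup>2)"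
    by (simp add: col_count_all power2_eq_square)
  also have "\<dots> = v * (k + (v - 1) * lam)"
    by (simp add: sum_col_count_squared)
  finally show ?thesis using k_less by simp
qed

lemma order_identity_int: "int lam * (int v - 1) = int k * (int k - 1)"
proof -
  have "int (k * k) = int (k + (v - 1) * lam)"
    using order_identity by (simp only:)
  then show ?thesis
    using k_less by (cases v) (simp_all add: algebra_simps)
qed

text \<open>The factor \<open>v - 2 * k + lam\<close> is the number of blocks that miss two given
  points. The identity brings it into the variance bound below and later shows that it is
  positive.\<close>

lemma complement_identity:
  "int lam * (int v - 2 * int k + int lam) = (int k - int lam) * (int k - int lam - 1)"
  using order_identity_int by (simp add: algebra_simps)

text \<open>Columns in \<open>W\<close> have the largest possible count \<open>card S\<close>. Since
  the first two moments of the column counts of \<open>S\<close> are known, so are the moments over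
  the columns outside \<open>W\<close>, and Cauchy-Schwarz there limits the size of
  \<open>W\<close>.\<close>

lemma all_ones_submatrix_bound:
  assumes S: "S \<subseteq> {..<v}" "S \<noteq> {}" and W: "W \<subseteq> {..<v}"
    and ones: "\<And>i t. i \<in> S \<Longrightarrow> t \<in> W \<Longrightarrow> A i t = 1"
  shows "int (card S) * int (card W) * (int k - int lam - 1)
    \<le> int lam * (int v - int (card S) - int (card W))"
proof -
  define s w n l where "s = int (card S)" and "w = int (card W)"
    and "n = int k - int lam" and "l = int lam"
  define d where "d t = int (col_count A S t)" for t
  have finS: "finite S" and finW: "finite W"
    using S W finite_subset by blast+
  have s_pos: "s > 0" using S finS by (simp add: s_def card_gt_0_iff)
  have n_pos: "n > 0" using lam_less by (simp add: n_def)
  have l_pos: "l > 0" using lam_pos by (simp add: l_def)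
  have dW: "d t = s" if "t \<in> W" for t
    using ones that by (simp add: d_def col_count_def s_def)
  have split: "(\<Sum>t<v. f t) = (\<Sum>t\<in>{..<v} - W. f t) + (\<Sum>t\<in>W. f t)" for f :: "nat \<Rightarrow> int"
    using W by (simp add: sum.subset_diff)
  have "(\<Sum>t<v. d t) = s * int k"
    unfolding d_def s_def of_nat_sum[symmetric] sum_col_count[OF S(1)] by simp
  then have sum1: "(\<Sum>t\<in>{..<v} - W. d t) = s * (int k - w)"
    using split[of d] dW by (simp add: w_def algebra_simps)
  have "card S \<ge> 1" using s_pos by (simp add: s_def)
  then have "(\<Sum>t<v. (d t)\<^sup>2) = s * (int k + (s - 1) * l)"
    unfolding d_def of_nat_power[symmetric] of_nat_sum[symmetric] sum_col_count_squared[OF S(1)]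
    by (simp add: s_def l_def of_nat_diff)
  then have sum2: "(\<Sum>t\<in>{..<v} - W. (d t)\<^sup>2) = s * (int k + (s - 1) * l) - w * s\<^sup>2"
    using split[of "\<lambda>t. (d t)\<^sup>2"] dW by (simp add: w_def)
  \<comment> \<open>Cauchy-Schwarz for the counts outside \<open>W\<close>, taken in the reals and
    carried back to the integers.\<close>
  have "real_of_int ((\<Sum>t\<in>{..<v} - W. d t)\<^sup>2)
      \<le> real_of_int ((\<Sum>t\<in>{..<v} - W. (d t)\<^sup>2) * int (card ({..<v} - W)))"
    using sum_squared_le_sum_of_squares[of "\<lambda>t. real_of_int (d t)" "{..<v} - W"]
    by simp
  then have "(s * (int k - w))\<^sup>2 \<le> (s * (int k + (s - 1) * l) - w * s\<^sup>2) * int (card ({..<v} - W))"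
    unfolding sum1 sum2 by linarith
  moreover have "int (card ({..<v} - W)) = int v - w"
    using W finW card_mono[OF finite_lessThan W] by (simp add: card_Diff_subset w_def of_nat_diff)
  ultimately have "s * (s * (int k - w)\<^sup>2) \<le> s * ((n + s * l - w * s) * (int v - w))"
    by (simp add: n_def l_def power2_eq_square algebra_simps)
  then have ineq: "s * (int k - w)\<^sup>2 \<le> (n + s * l - w * s) * (int v - w)"
    using s_pos by simp
  have id: "l * int v = int k * int k - n"
    using order_identity_int by (simp add: l_def n_def algebra_simps)
  have mu: "l * (int v - 2 * int k + l) = n * (n - 1)"
    using complement_identity by (simp add: l_def n_def)
  have expand: "s * (int k - w)\<^sup>2 - (n + s * l - w * s) * (int v - w)
      = s * w * (int v - 2 * int k + l) + n * (s + w - int v)"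
    using id by algebra
  \<comment> \<open>Multiplication by \<open>l\<close> turns \<open>v - 2 * k + l\<close> into
    \<open>n * (n - 1)\<close> through \<open>mu\<close>; the common positive factor
    \<open>n\<close> can then be cancelled.\<close>
  have "l * (s * w * (int v - 2 * int k + l) + n * (s + w - int v)) \<le> 0"
    using ineq expand l_pos by (simp add: mult_le_0_iff)
  moreover have "l * (s * w * (int v - 2 * int k + l) + n * (s + w - int v))
      = n * (s * w * (n - 1) - l * (int v - s - w))"
    using mu by algebra
  ultimately have "s * w * (n - 1) - l * (int v - s - w) \<le> 0"
    using n_pos by (simp add: mult_le_0_iff)
  then show ?thesis
    by (simp add: s_def w_def n_def l_def algebra_simps)
qed

text \<open>On the columns of row \<open>i\<close> the count of \<open>F\<close> is 1 or 2, so its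
  sum along the row exceeds the row sum \<open>k\<close> by the number of columns with count 2. Row
  inner products give \<open>(card F - 1) * lam\<close> for the same excess.\<close>

lemma
  assumes F: "pairwise_separated v A F" and i: "i \<in> F"
  shows card_shared_columns:
      "card {t. t < v \<and> A i t = 1 \<and> col_count A F t = 2} = lam * (card F - 1)"
    and private_or_shared: "t < v \<Longrightarrow> A i t = 1 \<Longrightarrow> col_count A F t = 1 \<or> col_count A F t = 2"
proof -
  have sub: "F \<subseteq> {..<v}" and le2: "\<And>t. t < v \<Longrightarrow> col_count A F t \<le> 2"
    using F by (auto simp: pairwise_separated_def)
  have iv: "i < v" using sub i by auto
  have fin: "finite F" using sub finite_subset by blast
  have one_or_two: "col_count A F t = 1 \<or> col_count A F t = 2" if "t < v" "A i t = 1" for t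
  proof -
    have "A i t \<le> col_count A F t"
      unfolding col_count_def using fin i by (intro member_le_sum) auto
    then show ?thesis using le2[OF that(1)] that(2) by linarith
  qed
  then show "t < v \<Longrightarrow> A i t = 1 \<Longrightarrow> col_count A F t = 1 \<or> col_count A F t = 2" .
  have "k + (card F - 1) * lam = (\<Sum>t<v. A i t * col_count A F t)"
    using sum_entry_col_count[OF sub i] by simp
  also have "\<dots> = (\<Sum>t<v. A i t + A i t * of_bool (col_count A F t = 2))"
  proof (rule sum.cong[OF refl])
    fix t assume "t \<in> {..<v}"
    then show "A i t * col_count A F t = A i t + A i t * of_bool (col_count A F t = 2)"
      using entry[OF iv, of t] one_or_two[of t] by auto
  qed
  also have "\<dots> = k + card {t. t < v \<and> A i t = 1 \<and> col_count A F t = 2}"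
    unfolding sum.distrib row_sum[OF iv] sum_entries_card[OF iv] ..
  finally show "card {t. t < v \<and> A i t = 1 \<and> col_count A F t = 2} = lam * (card F - 1)"
    by (simp add: mult.commute)
qed

text \<open>Row \<open>i\<close> has \<open>k\<close> ones, of which only
  \<open>lam * (card F - 1)\<close> lie in shared columns.\<close>

lemma ex_private_column:
  assumes F: "pairwise_separated v A F" and i: "i \<in> F" and k: "lam * (card F - 1) < k"
  shows "\<exists>t<v. A i t = 1 \<and> col_count A F t = 1"
proof (rule ccontr)
  assume "\<not> ?thesis"
  then have "tgt v A i \<subseteq> {t. t < v \<and> A i t = 1 \<and> col_count A F t = 2}"
    using private_or_shared[OF F i] by (auto simp: tgt_def)
  then have "card (tgt v A i) \<le> lam * (card F - 1)"
    unfolding card_shared_columns[OF F i, symmetric] by (rule card_mono[rotated]) auto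
  moreover have "i < v" using F i by (auto simp: pairwise_separated_def)
  ultimately show False using k by (simp add: card_tgt)
qed

lemma col_count_one_unique:
  assumes "F \<subseteq> {..<v}" and "t < v" and "col_count A F t = 1"
    and "i \<in> F" "j \<in> F" "A i t = 1" "A j t \<noteq> 0"
  shows "i = j"
proof -
  have "A j t = 1" using entry[of j t] assms by auto
  then have "i \<in> F \<inter> src v A t" "j \<in> F \<inter> src v A t"
    using assms by (auto simp: src_def)
  moreover have "card (F \<inter> src v A t) = 1"
    using assms col_count_card by simp
  ultimately show ?thesis by (metis card_1_singletonE singletonD)
qed

text \<open>Hall's theorem for the zero entries. If \<open>J\<close> violates the condition, the
  columns \<open>W\<close> outside \<open>C\<close> without a zero in the rows of \<open>J\<close>
  form an all-ones submatrix with \<open>J\<close>, too large for the variance bound.\<close>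

lemma ex_zero_transversal:
  assumes F: "F \<subseteq> {..<v}" and C: "C \<subseteq> {..<v}" "card C = card F"
    and p: "card F \<ge> 2" and k: "k \<ge> lam * (card F - 1) + 2"
  shows "\<exists>f. inj_on f ({..<v} - F) \<and> (\<forall>h\<in>{..<v} - F. f h \<in> {..<v} - C \<and> A h (f h) = 0)"
proof -
  define N where "N h = {t \<in> {..<v} - C. A h t = 0}" for h
  have finF: "finite F" and finC: "finite C" using F C finite_subset by blast+
  have "card J \<le> card (\<Union>(N ` J))" if J: "J \<subseteq> {..<v} - F" for J
  proof (rule ccontr)
    assume less: "\<not> ?thesis"
    define W where "W = {..<v} - C - \<Union>(N ` J)"
    have Jv: "J \<subseteq> {..<v}" using J by auto
    have Nsub: "\<Union>(N ` J) \<subseteq> {..<v} - C" by (auto simp: N_def)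
    have ones: "A i t = 1" if "i \<in> J" "t \<in> W" for i t
    proof -
      have "i < v" "t < v" "A i t \<noteq> 0"
        using that Jv by (auto simp: W_def N_def)
      then show ?thesis using entry[of i t] by simp
    qed
    have ne: "J \<noteq> {}" using less by (metis card.empty le0)
    have "card W = card ({..<v} - C) - card (\<Union>(N ` J))"
      unfolding W_def using Nsub by (intro card_Diff_subset) (auto intro: finite_subset)
    moreover have "card ({..<v} - C) = v - card F"
      using C finC by (simp add: card_Diff_subset)
    moreover have "card J \<le> v - card F"
      using card_mono[OF _ J] F finF by (simp add: card_Diff_subset)
    moreover have "card J \<ge> 1"
      using ne Jv finite_subset by (metis One_nat_def Suc_leI card_gt_0_iff finite_lessThan)
    moreover have pv: "card F \<le> v" using card_mono[OF _ F] by simp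
    \<comment> \<open>The rows in \<open>J\<close> have at most \<open>card J - 1\<close> admissible
      columns, and \<open>W\<close> is the rest of the \<open>v - card F\<close> columns outside
      \<open>C\<close>.\<close>
    ultimately have sw: "int (card J) + int (card W) \<ge> int v - int (card F) + 1"
      "int (card J) \<ge> 1" "int (card W) \<ge> 1"
      using less by auto
    define s w p n l where defs: "s = int (card J)" "w = int (card W)" "p = int (card F)"
      "n = int k - int lam" "l = int lam"
    have sw': "s + w \<ge> int v - p + 1" "s \<ge> 1" "w \<ge> 1" using sw by (simp_all add: defs)
    have l1: "l \<ge> 1" using lam_pos by (simp add: defs)
    have p2: "p \<ge> 2" using p by (simp add: defs)
    have "int k \<ge> int (lam * (card F - 1) + 2)" using k by linarith
    then have kl: "int k \<ge> l * (p - 1) + 2"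
      using p by (simp add: defs of_nat_diff)
    \<comment> \<open>From \<open>k \<ge> l * (p - 1) + 2\<close> follows
      \<open>n \<ge> l * (p - 2) + 2 \<ge> p\<close>, so \<open>n - 1\<close> is at least 1.\<close>
    have "1 * (p - 2) \<le> l * (p - 2)"
      using l1 p2 by (intro mult_right_mono) auto
    also have "\<dots> \<le> n - 2" using kl by (simp add: defs algebra_simps)
    finally have np: "n \<ge> p" by simp
    have "W \<subseteq> {..<v}" by (auto simp: W_def)
    then have "s * w * (n - 1) \<le> l * (int v - s - w)"
      using all_ones_submatrix_bound[OF Jv ne _ ones] by (simp add: defs)
    also have "\<dots> \<le> l * (p - 1)"
      using l1 sw' by (intro mult_left_mono) auto
    finally have upper: "s * w * (n - 1) \<le> int k - 2" using kl by linarith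
    have "s * w * 1 \<le> s * w * (n - 1)"
      using sw' np p2 by (intro mult_left_mono) auto
    \<comment> \<open>With \<open>s\<close> and \<open>w\<close> at least 1 the product is at least
      \<open>s + w - 1\<close>, hence at least \<open>v - p\<close>.\<close>
    moreover have "(s - 1) * (w - 1) \<ge> 0" using sw' by simp
    then have "s * w \<ge> s + w - 1" by (simp add: algebra_simps)
    ultimately have vp: "int v - p \<le> int k - 2" using upper sw' by linarith
    \<comment> \<open>Here \<open>v > 2 * k - l\<close>, so
      \<open>v - p > k + n - p \<ge> k\<close>, contrary to \<open>vp\<close>.\<close>
    have "l * (int v - 2 * int k + l) > 0"
      using complement_identity np p2 by (simp add: defs)
    then have "int v - 2 * int k + l > 0" using l1 by (simp add: zero_less_mult_iff)
    then show False using vp np by (simp add: defs)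
  qed
  then obtain f where "inj_on f ({..<v} - F)" "\<forall>h\<in>{..<v} - F. f h \<in> N h"
    using hall_distinct_representatives[of "{..<v} - F" N] by (auto simp: N_def)
  then show ?thesis by (auto simp: N_def)
qed

lemma ex_private_relabeling:
  assumes F: "pairwise_separated v A F" and p: "card F \<ge> 2"
    and k: "k \<ge> lam * (card F - 1) + 2"
  shows "\<exists>\<pi>. \<pi> permutes {..<v} \<and> zero_diagonal v (relabel_columns \<pi> A) \<and>
    admits_private_target_permutation v (relabel_columns \<pi> A) F"
proof -
  have sub: "F \<subseteq> {..<v}" using F by (simp add: pairwise_separated_def)
  then have finF: "finite F" using finite_subset by blast
  have "\<forall>i\<in>F. \<exists>t<v. A i t = 1 \<and> col_count A F t = 1"
    using ex_private_column[OF F] k by auto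
  then obtain c where c: "\<And>i. i \<in> F \<Longrightarrow> c i < v \<and> A i (c i) = 1 \<and> col_count A F (c i) = 1"
    by metis
  \<comment> \<open>Within \<open>F\<close>, the column \<open>c i\<close> is met by row
    \<open>i\<close> alone.\<close>
  have c_unique: "i = j" if "i \<in> F" "j \<in> F" "A j (c i) \<noteq> 0" for i j
    using col_count_one_unique[OF sub, of "c i" i j] c that by blast
  have inj_c: "inj_on c F"
    using c c_unique by (intro inj_onI) (metis zero_neq_one)
  obtain \<sigma> where \<sigma>: "\<sigma> permutes F" "\<And>i. i \<in> F \<Longrightarrow> \<sigma> i \<noteq> i"
    using ex_fixpoint_free_permutation[OF finF p] by blast
  have "\<exists>f. inj_on f ({..<v} - F) \<and> (\<forall>h\<in>{..<v} - F. f h \<in> {..<v} - c ` F \<and> A h (f h) = 0)"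
    using c by (intro ex_zero_transversal[OF sub _ card_image[OF inj_c] p k]) blast
  then obtain f where f: "inj_on f ({..<v} - F)"
    "\<And>h. h \<in> {..<v} - F \<Longrightarrow> f h \<in> {..<v} - c ` F \<and> A h (f h) = 0"
    by blast
  define \<tau> where "\<tau> = inv \<sigma>"
  have \<tau>: "\<tau> permutes F" using \<sigma> by (simp add: \<tau>_def permutes_inv)
  have \<tau>F: "\<tau> l \<in> F" if "l \<in> F" for l using \<tau> that by (simp add: permutes_in_image)
  have \<tau>\<sigma>: "\<tau> (\<sigma> i) = i" for i using \<sigma> by (simp add: \<tau>_def permutes_inverses)
  have \<tau>ne: "\<tau> l \<noteq> l" if "l \<in> F" for l
    using \<sigma> that by (metis \<tau>F \<tau>_def permutes_inverses(1))
  \<comment> \<open>\<open>\<pi> l\<close> is the old column that receives label \<open>l\<close>.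
    Column \<open>c i\<close> is to carry label \<open>\<sigma> i\<close>, hence the inverse
    \<open>\<tau>\<close> of \<open>\<sigma>\<close>.\<close>
  define \<pi> where "\<pi> l = (if l \<in> F then c (\<tau> l) else if l < v then f l else l)" for l
  have "inj_on \<pi> {..<v}"
  proof (rule inj_onI)
    fix a b assume ab: "a \<in> {..<v}" "b \<in> {..<v}" "\<pi> a = \<pi> b"
    \<comment> \<open>Labels in \<open>F\<close> receive private columns and all other labels
      receive the rest, so collisions need only be excluded within each kind.\<close>
    have img: "\<pi> l \<in> c ` F \<longleftrightarrow> l \<in> F" if "l \<in> {..<v}" for l
      using that f(2)[of l] \<tau>F by (auto simp: \<pi>_def)
    show "a = b"
    proof (cases "a \<in> F")
      case True
      then have "b \<in> F" using img ab by metis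
      then have "\<tau> a = \<tau> b" using True ab inj_c \<tau>F by (auto simp: \<pi>_def inj_on_def)
      then show ?thesis using \<tau> by (meson injD permutes_inj)
    next
      case False
      then have "b \<notin> F" using img ab by metis
      then show ?thesis using False ab f(1) by (auto simp: \<pi>_def inj_on_def)
    qed
  qed
  moreover have "\<pi> l \<in> {..<v}" if "l \<in> {..<v}" for l
    using that f(2)[of l] c[OF \<tau>F] by (auto simp: \<pi>_def)
  ultimately have perm: "\<pi> permutes {..<v}"
    by (intro inj_imp_permutes) (use sub in \<open>auto simp: \<pi>_def\<close>)
  have "zero_diagonal v (relabel_columns \<pi> A)"
    unfolding zero_diagonal_def relabel_columns_def
  proof (intro allI impI)
    fix l assume l: "l < v"
    show "A l (\<pi> l) = 0"
    proof (cases "l \<in> F")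
      case True
      \<comment> \<open>The column at label \<open>l\<close> meets \<open>F\<close> only in row
        \<open>\<tau> l\<close>, which differs from \<open>l\<close>.\<close>
      then show ?thesis using c_unique[of "\<tau> l" l] \<tau>F \<tau>ne by (auto simp: \<pi>_def)
    next
      case False
      then show ?thesis using f(2)[of l] l by (simp add: \<pi>_def)
    qed
  qed
  moreover have cc: "col_count (relabel_columns \<pi> A) F t = col_count A F (\<pi> t)" for t
    by (simp add: col_count_def relabel_columns_def)
  have "pairwise_separated v (relabel_columns \<pi> A) F"
    using F permutes_in_image[OF perm] by (simp add: pairwise_separated_def cc)
  moreover have "\<sigma> i \<in> tgt v (relabel_columns \<pi> A) i \<and> col_count (relabel_columns \<pi> A) F (\<sigma> i) = 1"
    if "i \<in> F" for i
  proof -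
    have "\<sigma> i \<in> F" using \<sigma> that by (simp add: permutes_in_image)
    then have "\<pi> (\<sigma> i) = c i" "\<sigma> i < v" using sub \<tau>\<sigma> by (auto simp: \<pi>_def)
    then show ?thesis using c[OF that] by (simp add: cc) (simp add: tgt_def relabel_columns_def)
  qed
  ultimately show ?thesis
    using perm \<sigma>(1) unfolding admits_private_target_permutation_def by blast
qed

section \<open>Recovery with many replicas\<close>

text \<open>With \<open>d\<close> the column counts of \<open>Y\<close>, each column contributes at
  most \<open>d^2 - d\<close> to the blocked targets, plus 1 if it lies in \<open>X\<close>: for
  \<open>d = 1\<close> only membership in \<open>X\<close> can block, and for
  \<open>d \<ge> 2\<close> the square is at least \<open>2 * d\<close>. The second moment of
  \<open>d\<close> then gives the bound.\<close>

lemma blocked_targets_bound: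
  assumes X: "X \<subseteq> {..<v}" and Y: "Y \<subseteq> X"
    and q: "\<And>i. i \<in> Y \<Longrightarrow>
      q \<le> card {t. t < v \<and> A i t = 1 \<and> (t \<in> X \<or> col_count A Y t \<ge> 2)}"
  shows "q * card Y \<le> lam * card Y * (card Y - 1) + card X"
proof -
  define d where "d = col_count A Y"
  define blocked where "blocked t \<longleftrightarrow> t \<in> X \<or> d t \<ge> 2" for t
  have Yv: "Y \<subseteq> {..<v}" using X Y by auto
  have finX: "finite X" using X finite_subset by blast
  have "q * card Y = (\<Sum>i\<in>Y. q)" by simp
  also have "\<dots> \<le> (\<Sum>i\<in>Y. \<Sum>t<v. A i t * of_bool (blocked t))"
  proof (rule sum_mono)
    fix i assume "i \<in> Y"
    then show "q \<le> (\<Sum>t<v. A i t * of_bool (blocked t))"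
      using q[of i] Yv by (subst sum_entries_card) (auto simp: blocked_def d_def)
  qed
  also have "\<dots> = (\<Sum>t<v. d t * of_bool (blocked t))"
    unfolding d_def col_count_def sum_distrib_right by (rule sum.swap)
  \<comment> \<open>The sum of \<open>d\<close> is added on both sides to avoid the truncated
    subtraction in \<open>d^2 - d\<close>.\<close>
  finally have "q * card Y + (\<Sum>t<v. d t) \<le> (\<Sum>t<v. d t * of_bool (blocked t) + d t)"
    by (simp add: sum.distrib)
  also have "\<dots> \<le> (\<Sum>t<v. (d t)\<^sup>2 + of_bool (t \<in> X))"
  proof (rule sum_mono)
    fix t
    have "d t = 0 \<or> d t = 1 \<or> 2 * d t \<le> (d t)\<^sup>2"
      by (cases "d t \<ge> 2") (auto simp: power2_eq_square)
    then show "d t * of_bool (blocked t) + d t \<le> (d t)\<^sup>2 + of_bool (t \<in> X)"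
      by (auto simp: blocked_def)
  qed
  also have "\<dots> = card Y * (k + (card Y - 1) * lam) + card ({..<v} \<inter> X)"
    unfolding sum.distrib by (simp add: d_def sum_col_count_squared[OF Yv])
  also have "{..<v} \<inter> X = X" using X by auto
  finally show ?thesis
    by (simp add: d_def sum_col_count[OF Yv] distrib_left mult_ac)
qed

text \<open>With \<open>y = card Y\<close> and \<open>p = y + z\<close>, one more replica would give
  \<open>lam * y * z + 2 * y \<le> y + z\<close>, impossible since \<open>lam * y \<ge> 1\<close>
  and \<open>y \<ge> 1\<close>.\<close>

lemma blocked_targets_imp_few_replicas:
  assumes X: "X \<subseteq> {..<v}" "card X \<le> p" and Y: "Y \<subseteq> X" "Y \<noteq> {}"
    and q: "\<And>i. i \<in> Y \<Longrightarrow>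
      q \<le> card {t. t < v \<and> A i t = 1 \<and> (t \<in> X \<or> col_count A Y t \<ge> 2)}"
  shows "q \<le> lam * (p - 1) + 1"
proof (rule ccontr)
  assume "\<not> ?thesis"
  then have many: "lam * (p - 1) + 2 \<le> q" by simp
  have finX: "finite X" using X finite_subset by blast
  define y where "y = card Y"
  have y: "1 \<le> y" "y \<le> p"
    using X Y finX card_mono[OF finX Y(1)] finite_subset[OF Y(1) finX]
    by (auto simp: y_def Suc_le_eq card_gt_0_iff)
  obtain z where z: "p = y + z" using y le_Suc_ex by blast
  obtain u where u: "y = Suc u" using y by (cases y) auto
  have "(lam * (p - 1) + 2) * y \<le> q * y"
    using many by (intro mult_right_mono) auto
  also have "\<dots> \<le> lam * y * (y - 1) + p"
    using blocked_targets_bound[OF X(1) Y(1) q] X(2) by (simp add: y_def)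
  finally have "lam * y * z + 2 * y \<le> y + z"
    by (simp add: z u algebra_simps)
  moreover have "1 * z \<le> (lam * y) * z"
    using lam_pos y by (intro mult_right_mono) auto
  ultimately show False using y by linarith
qed

text \<open>Equal parities rule out a single differing summand in the tuple of \<open>x\<close>. A
  second differing object comes from another primary node, because each source contributes only one
  replica to a tuple.\<close>

lemma tuple_second_difference:
  assumes legal: "legal_placement v k A q D" and val: "valuation D w" "valuation D w'"
    and t: "t < v" and x: "x \<in> received D t" "w x \<noteq> w' x"
    and par: "\<And>U. U \<in> tuples D t \<Longrightarrow> parity (word_length D) w U = parity (word_length D) w' U"
  shows "\<exists>y\<in>objects D. w y \<noteq> w' y \<and> primary D y \<noteq> primary D x \<and> A (primary D y) t = 1"
proof -
  have part: "partition_on (received D t) (tuples D t)"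
    and tup: "\<And>U. U \<in> tuples D t \<Longrightarrow> \<forall>i\<in>src v A t. \<exists>!x. x \<in> U \<and> primary D x = i"
    and fin: "finite (objects D)"
    and obj: "\<And>x. x \<in> objects D \<Longrightarrow> primary D x < v \<and> targets D x \<subseteq> tgt v A (primary D x)"
    using legal t unfolding legal_placement_def by blast+
  obtain U where U: "U \<in> tuples D t" "x \<in> U"
    using part x(1) unfolding partition_on_def by blast
  have Urec: "U \<subseteq> received D t" using part U unfolding partition_on_def by blast
  have Uobj: "U \<subseteq> objects D" using Urec by (auto simp: received_def)
  have finU: "finite U" using Uobj fin finite_subset by blast
  have len: "length (w x) = word_length D" "length (w' x) = word_length D"
    using val U Uobj by (auto simp: valuation_def)
  then obtain c where c: "c < word_length D" "w x ! c \<noteq> w' x ! c"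
    using x(2) nth_equalityI[of "w x" "w' x"] by auto
  have "parity (word_length D) w U ! c = parity (word_length D) w' U ! c"
    using par[OF U(1)] by simp
  then have eq: "(\<Sum>y\<in>U. w y ! c) = (\<Sum>y\<in>U. w' y ! c)"
    using c by (simp add: parity_def)
  have "\<exists>y\<in>U - {x}. w y \<noteq> w' y"
  proof (rule ccontr)
    assume "\<not> ?thesis"
    then have "(\<Sum>y\<in>U - {x}. w y ! c) = (\<Sum>y\<in>U - {x}. w' y ! c)"
      by (intro sum.cong) auto
    then have "w x ! c + (\<Sum>y\<in>U - {x}. w y ! c) = w' x ! c + (\<Sum>y\<in>U - {x}. w y ! c)"
      using eq sum.remove[OF finU U(2)] by metis
    then show False using c(2) by (simp only: add_right_cancel)
  qed
  then obtain y where y: "y \<in> U" "y \<noteq> x" "w y \<noteq> w' y" by blast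
  have src: "primary D z \<in> src v A t" if "z \<in> U" for z
    using that Urec obj by (auto simp: received_def src_def tgt_def)
  have "primary D y \<noteq> primary D x"
    using tup[OF U(1)] src[OF U(2)] y U(2) by metis
  then show ?thesis using y Uobj src[of y] by (auto simp: src_def)
qed

lemma universally_recoverable_above:
  assumes q: "q \<ge> lam * (p - 1) + 2"
  shows "universally_recoverable v k A p q"
  unfolding universally_recoverable_def permits_recovery_def
proof (intro allI impI, elim conjE)
  fix D X w w'
  assume legal: "legal_placement v k A q D" and X: "X \<subseteq> {..<v}" "card X \<le> p"
    and val: "valuation D w" "valuation D w'"
    and alive: "\<forall>x\<in>objects D. primary D x \<notin> X \<longrightarrow> w x = w' x"
    and par: "\<forall>j<v. j \<notin> X \<longrightarrow>
      (\<forall>U\<in>tuples D j. parity (word_length D) w U = parity (word_length D) w' U)"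
  define Y where "Y = primary D ` {x \<in> objects D. w x \<noteq> w' x}"
  have obj: "\<And>x. x \<in> objects D \<Longrightarrow> targets D x \<subseteq> tgt v A (primary D x) \<and> card (targets D x) = q"
    using legal unfolding legal_placement_def by blast
  have YX: "Y \<subseteq> X" using alive by (auto simp: Y_def)
  have Yv: "Y \<subseteq> {..<v}" using YX X by auto
  have finY: "finite Y" using Yv finite_subset by blast
  have blocked: "q \<le> card {t. t < v \<and> A i t = 1 \<and> (t \<in> X \<or> col_count A Y t \<ge> 2)}" if i: "i \<in> Y" for i
  proof -
    obtain x where x: "x \<in> objects D" "w x \<noteq> w' x" "primary D x = i"
      using i unfolding Y_def by blast
    have "targets D x \<subseteq> {t. t < v \<and> A i t = 1 \<and> (t \<in> X \<or> col_count A Y t \<ge> 2)}"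
    proof
      fix t assume t: "t \<in> targets D x"
      then have tv: "t < v" "A i t = 1" using obj[OF x(1)] x(3) by (auto simp: tgt_def)
      have "col_count A Y t \<ge> 2" if tX: "t \<notin> X"
      proof -
        have "x \<in> received D t" using x t by (simp add: received_def)
        then obtain y where y: "y \<in> objects D" "w y \<noteq> w' y" "primary D y \<noteq> i" "A (primary D y) t = 1"
          using tuple_second_difference[OF legal val tv(1) _ x(2)] par tv(1) tX x(3) by blast
        \<comment> \<open>Two distinct members of \<open>Y\<close> have an entry 1 in column
          \<open>t\<close>.\<close>
        have "(\<Sum>j\<in>{i, primary D y}. A j t) \<le> col_count A Y t"
          unfolding col_count_def
          using finY x y by (intro sum_mono2) (auto simp: Y_def)
        then show ?thesis using y tv by simp
      qed
      then show "t \<in> {t. t < v \<and> A i t = 1 \<and> (t \<in> X \<or> col_count A Y t \<ge> 2)}"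
        using tv by auto
    qed
    then have "card (targets D x) \<le> card {t. t < v \<and> A i t = 1 \<and> (t \<in> X \<or> col_count A Y t \<ge> 2)}"
      by (rule card_mono[rotated]) auto
    then show ?thesis using obj[OF x(1)] by simp
  qed
  have "Y = {}"
  proof (rule ccontr)
    assume "Y \<noteq> {}"
    then show False
      using blocked_targets_imp_few_replicas[OF X YX _ blocked] q by simp
  qed
  then show "\<forall>x\<in>objects D. primary D x \<in> X \<longrightarrow> w x = w' x"
    by (auto simp: Y_def)
qed

end

section \<open>An unrecoverable placement with few replicas\<close>

text \<open>The number \<open>x\<close> names the object that is stored at \<open>obj_node x\<close> and replicated at
  \<open>obj_targets x\<close>; every pair of a node and a finite set has exactly one name.\<close>

definition obj_node :: "nat \<Rightarrow> nat" where
  "obj_node x = fst (prod_decode x)"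

definition obj_targets :: "nat \<Rightarrow> nat set" where
  "obj_targets x = set_decode (snd (prod_decode x))"

definition all_objects :: "nat \<Rightarrow> (nat \<Rightarrow> nat \<Rightarrow> nat) \<Rightarrow> nat \<Rightarrow> nat set" where
  "all_objects v A q = {x. obj_node x < v \<and> obj_targets x \<subseteq> tgt v A (obj_node x) \<and> card (obj_targets x) = q}"

lemma object_eqI: "obj_node x = obj_node y \<Longrightarrow> obj_targets x = obj_targets y \<Longrightarrow> x = y"
  unfolding obj_node_def obj_targets_def
  by (metis prod.expand prod_decode_inverse set_decode_inverse)

lemma ex_object: "finite T \<Longrightarrow> \<exists>x. obj_node x = i \<and> obj_targets x = T"
  by (rule exI[of _ "prod_encode (i, set_encode T)"]) (simp add: obj_node_def obj_targets_def)

lemma finite_all_objects: "finite (all_objects v A q)"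
proof (rule inj_on_finite)
  show "inj_on (\<lambda>x. (obj_node x, obj_targets x)) (all_objects v A q)"
    by (rule inj_onI) (simp add: object_eqI)
  show "(\<lambda>x. (obj_node x, obj_targets x)) ` all_objects v A q \<subseteq> {..<v} \<times> Pow {..<v}"
    by (auto simp: all_objects_def tgt_def)
qed simp

text \<open>The count depends on \<open>S\<close> only through its size, so different sources of a
  node have equally many replicas there to group.\<close>

lemma card_objects_containing:
  assumes "finite S" and "j \<in> S"
  shows "card {x. obj_node x = i \<and> obj_targets x \<subseteq> S \<and> j \<in> obj_targets x \<and> card (obj_targets x) = q}
    = (card S choose q) - ((card S - 1) choose q)"
proof -
  let ?X = "{x. obj_node x = i \<and> obj_targets x \<subseteq> S \<and> j \<in> obj_targets x \<and> card (obj_targets x) = q}"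
  have "inj_on obj_targets ?X"
    by (rule inj_onI) (simp add: object_eqI)
  then have "card ?X = card (obj_targets ` ?X)"
    by (rule card_image[symmetric])
  also have "obj_targets ` ?X = {T. T \<subseteq> S \<and> j \<in> T \<and> card T = q}"
  proof
    show "{T. T \<subseteq> S \<and> j \<in> T \<and> card T = q} \<subseteq> obj_targets ` ?X"
    proof
      fix T assume T: "T \<in> {T. T \<subseteq> S \<and> j \<in> T \<and> card T = q}"
      then have "finite T" using assms(1) finite_subset by auto
      then obtain x where "obj_node x = i" "obj_targets x = T"
        using ex_object by blast
      then show "T \<in> obj_targets ` ?X" using T by (intro image_eqI[of _ _ x]) auto
    qed
  qed auto
  finally show ?thesis using card_subsets_containing[OF assms] by simp
qed

section \<open>Aligned tuples and flips that no alive parity detects\<close>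

context design_matrix
begin

lemma ex_aligned_placement:
  assumes S: "\<And>i. i \<in> F \<Longrightarrow> S i \<subseteq> tgt v A i" "\<And>i. i \<in> F \<Longrightarrow> card (S i) = c"
  shows "\<exists>D. legal_placement v k A q D \<and> word_length D = 1 \<and>
    objects D = all_objects v A q \<and> primary D = obj_node \<and> targets D = obj_targets \<and>
    (\<forall>j<v. \<forall>U\<in>tuples D j. \<forall>x\<in>U. \<forall>y\<in>U.
       obj_node x \<in> F \<and> j \<in> S (obj_node x) \<and> obj_node y \<in> F \<and> j \<in> S (obj_node y) \<longrightarrow>
       (obj_targets x \<subseteq> S (obj_node x) \<longleftrightarrow> obj_targets y \<subseteq> S (obj_node y)))"
proof -
  \<comment> \<open>Every source sends \<open>n\<close> replicas to each of its targets
    \<open>j\<close>; if \<open>j \<in> S i\<close>, exactly \<open>m\<close> of those from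
    \<open>i\<close> belong to objects with all targets in \<open>S i\<close>. Neither number
    depends on \<open>i\<close> or \<open>j\<close>.\<close>
  define n m where "n = (k choose q) - ((k - 1) choose q)"
    and "m = (c choose q) - ((c - 1) choose q)"
  define Rec where "Rec j = {x \<in> all_objects v A q. j \<in> obj_targets x}" for j
  define Cls where "Cls j i = {x \<in> Rec j. obj_node x = i}" for j i
  have finCls: "finite (Cls j i)" for j i
    by (rule finite_subset[OF _ finite_all_objects]) (auto simp: Cls_def Rec_def)
  have cardCls: "card (Cls j i) = n" if "i \<in> src v A j" "j < v" for i j
  proof -
    have "i < v" "j \<in> tgt v A i" using that by (auto simp: src_def tgt_def)
    moreover have "finite (tgt v A i)" by (simp add: tgt_def)
    moreover have "Cls j i = {x. obj_node x = i \<and> obj_targets x \<subseteq> tgt v A i \<and> j \<in> obj_targets x \<and> card (obj_targets x) = q}"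
      using \<open>i < v\<close> by (auto simp: Cls_def Rec_def all_objects_def)
    ultimately show ?thesis using card_objects_containing[of "tgt v A i" j i q] card_tgt
      by (simp add: n_def)
  qed
  have "\<exists>h. bij_betw h (Cls j i) {..<n} \<and>
      (i \<in> F \<and> j \<in> S i \<longrightarrow> (\<forall>x\<in>Cls j i. h x < m \<longleftrightarrow> obj_targets x \<subseteq> S i))"
    if ij: "j < v" "i \<in> src v A j" for i j
  proof (cases "i \<in> F \<and> j \<in> S i")
    case True
    define X where "X = {x \<in> Cls j i. obj_targets x \<subseteq> S i}"
    have iv: "i < v" using ij by (simp add: src_def)
    have fin: "finite (S i)"
      using S(1)[of i] True by (auto simp: tgt_def intro: finite_subset)
    have "X = {x. obj_node x = i \<and> obj_targets x \<subseteq> S i \<and> j \<in> obj_targets x \<and> card (obj_targets x) = q}"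
      using iv S(1)[of i] True by (auto simp: X_def Cls_def Rec_def all_objects_def)
    then have "card X = m"
      using card_objects_containing[OF fin, of j i q] True S(2)[of i] by (simp add: m_def)
    moreover have "X \<subseteq> Cls j i" by (auto simp: X_def)
    ultimately obtain h where "bij_betw h (Cls j i) {..<n}" "\<forall>x\<in>Cls j i. h x < m \<longleftrightarrow> x \<in> X"
      using ex_bij_betw_initial_segment[OF finCls, of X j i] cardCls[OF ij(2,1)] by auto
    then show ?thesis by (auto simp: X_def)
  next
    case False
    \<comment> \<open>No alignment is required of this source, so any numbering will do.\<close>
    obtain h where "bij_betw h (Cls j i) {..<n}"
      using ex_bij_betw_initial_segment[OF finCls, of "{}" j i] cardCls[OF ij(2,1)] by auto
    then show ?thesis using False by blast
  qed
  then obtain H where H: "\<And>j i. j < v \<Longrightarrow> i \<in> src v A j \<Longrightarrow> bij_betw (H j i) (Cls j i) {..<n}"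
    "\<And>j i x. j < v \<Longrightarrow> i \<in> src v A j \<Longrightarrow> i \<in> F \<Longrightarrow> j \<in> S i \<Longrightarrow> x \<in> Cls j i \<Longrightarrow>
      H j i x < m \<longleftrightarrow> obj_targets x \<subseteq> S i"
    by metis
  \<comment> \<open>Each source numbers its replicas at \<open>j\<close> by \<open>H\<close>, those with targets inside \<open>S i\<close> first; equal
    numbers form a tuple.\<close>
  define tup where "tup j r = {x \<in> Rec j. H j (obj_node x) x = r}" for j r
  define D where "D = \<lparr>word_length = 1, objects = all_objects v A q, primary = obj_node,
    targets = obj_targets, tuples = (\<lambda>j. tup j ` {..<n})\<rparr>"
  have D_simps: "word_length D = 1" "objects D = all_objects v A q" "primary D = obj_node"
    "targets D = obj_targets" "tuples D j = tup j ` {..<n}" "received D j = Rec j" for j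
    by (simp_all add: D_def received_def Rec_def)
  have node_src: "obj_node x \<in> src v A j" if "x \<in> Rec j" for x j
    using that by (auto simp: Rec_def all_objects_def tgt_def src_def)
  have unique: "\<exists>!x. x \<in> tup j r \<and> obj_node x = i" if "j < v" "i \<in> src v A j" "r < n" for i j r
  proof -
    have "\<exists>!x. x \<in> Cls j i \<and> H j i x = r"
      using H(1)[OF that(1,2)] that(3) unfolding bij_betw_iff_bijections
      by (metis lessThan_iff)
    moreover have "x \<in> tup j r \<and> obj_node x = i \<longleftrightarrow> x \<in> Cls j i \<and> H j i x = r" for x
      by (auto simp: tup_def Cls_def)
    ultimately show ?thesis by simp
  qed
  have card_tup: "card (tup j r) = k" if "j < v" "r < n" for j r
  proof -
    have "bij_betw obj_node (tup j r) (src v A j)"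
      unfolding bij_betw_def
    proof
      show "inj_on obj_node (tup j r)"
      proof (rule inj_onI)
        fix x y assume xy: "x \<in> tup j r" "y \<in> tup j r" "obj_node x = obj_node y"
        then have "obj_node x \<in> src v A j" using node_src by (simp add: tup_def)
        then show "x = y" using unique[OF that(1) _ that(2)] xy by metis
      qed
      show "obj_node ` tup j r = src v A j"
      proof
        show "src v A j \<subseteq> obj_node ` tup j r"
          using unique[OF that(1) _ that(2)] by blast
      qed (use node_src in \<open>auto simp: tup_def\<close>)
    qed
    then show ?thesis using card_src that bij_betw_same_card by metis
  qed
  have "partition_on (Rec j) (tup j ` {..<n})" if "j < v" for j
  proof (rule partition_onI)
    show "\<Union> (tup j ` {..<n}) = Rec j"
    proof
      show "Rec j \<subseteq> \<Union> (tup j ` {..<n})"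
      proof
        fix x assume x: "x \<in> Rec j"
        then have "H j (obj_node x) x \<in> {..<n}"
          using bij_betwE[OF H(1)[OF that node_src[OF x]]] by (auto simp: Cls_def)
        then show "x \<in> \<Union> (tup j ` {..<n})" using x by (auto simp: tup_def)
      qed
    qed (auto simp: tup_def)
    show "disjnt U V" if "U \<in> tup j ` {..<n}" "V \<in> tup j ` {..<n}" "U \<noteq> V" for U V
      using that by (auto simp: tup_def disjnt_def)
    show "{} \<notin> tup j ` {..<n}"
    proof
      assume "{} \<in> tup j ` {..<n}"
      then obtain r where r: "r < n" "tup j r = {}" by auto
      then show False using card_tup[OF that r(1)] lam_less by simp
    qed
  qed
  then have "legal_placement v k A q D"
    unfolding legal_placement_def D_simps
    using finite_all_objects card_tup unique by (auto simp: all_objects_def)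
  moreover have "obj_targets x \<subseteq> S (obj_node x) \<longleftrightarrow> obj_targets y \<subseteq> S (obj_node y)"
    if j: "j < v" "U \<in> tuples D j" and U: "x \<in> U" "y \<in> U"
      and F: "obj_node x \<in> F" "j \<in> S (obj_node x)" "obj_node y \<in> F" "j \<in> S (obj_node y)"
    for j U x y
  proof -
    obtain r where r: "U = tup j r" using j D_simps by auto
    have "obj_targets z \<subseteq> S (obj_node z) \<longleftrightarrow> r < m"
      if z: "z \<in> U" "obj_node z \<in> F" "j \<in> S (obj_node z)" for z
    proof -
      have "z \<in> Rec j" "H j (obj_node z) z = r" using z r by (auto simp: tup_def)
      then show ?thesis using H(2)[OF j(1) node_src z(2,3), of z] by (auto simp: Cls_def)
    qed
    then show ?thesis using U F by blast
  qed
  ultimately show ?thesis using D_simps by blast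
qed

text \<open>A flipped object sends replicas only into \<open>S i\<close>, that is to the failed node
  \<open>\<sigma> i\<close> and to shared columns. Alignment makes the flips in a tuple at a shared
  alive column occur in pairs, and they cancel modulo 2.\<close>

lemma not_universally_recoverable_below:
  assumes priv: "admits_private_target_permutation v A F" and F: "F \<noteq> {}"
    and q: "q \<le> lam * (card F - 1) + 1"
  shows "\<not> universally_recoverable v k A (card F) q"
proof
  assume univ: "universally_recoverable v k A (card F) q"
  obtain \<sigma> where sep: "pairwise_separated v A F" and \<sigma>: "\<sigma> permutes F"
    "\<And>i. i \<in> F \<Longrightarrow> \<sigma> i \<in> tgt v A i \<and> col_count A F (\<sigma> i) = 1"
    using priv unfolding admits_private_target_permutation_def by blast
  have sub: "F \<subseteq> {..<v}" using sep by (simp add: pairwise_separated_def)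
  \<comment> \<open>The private column \<open>\<sigma> i\<close> has count 1 and is not among the
    shared ones, so it adds exactly one element.\<close>
  define S where "S i = insert (\<sigma> i) {t. t < v \<and> A i t = 1 \<and> col_count A F t = 2}" for i
  have S: "S i \<subseteq> tgt v A i" "card (S i) = lam * (card F - 1) + 1" if "i \<in> F" for i
    using \<sigma>(2)[OF that] card_shared_columns[OF sep that]
    by (auto simp: S_def tgt_def card_insert_if)
  obtain D where legal: "legal_placement v k A q D" and D: "word_length D = 1"
    "objects D = all_objects v A q" "primary D = obj_node" "targets D = obj_targets"
    and aligned: "\<forall>j<v. \<forall>U\<in>tuples D j. \<forall>x\<in>U. \<forall>y\<in>U.
       obj_node x \<in> F \<and> j \<in> S (obj_node x) \<and> obj_node y \<in> F \<and> j \<in> S (obj_node y) \<longrightarrow>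
       (obj_targets x \<subseteq> S (obj_node x) \<longleftrightarrow> obj_targets y \<subseteq> S (obj_node y))"
    by (rule exE[OF ex_aligned_placement[where F = F and q = q, OF S]])
      (assumption, assumption, elim conjE, rule that)
  define flip where "flip x \<longleftrightarrow> obj_node x \<in> F \<and> obj_targets x \<subseteq> S (obj_node x)" for x
  define w w' :: "nat \<Rightarrow> bit list" where "w x = [0]" and "w' x = [of_bool (flip x)]" for x
  have "parity (word_length D) w U = parity (word_length D) w' U"
    if j: "j < v" "j \<notin> F" and U: "U \<in> tuples D j" for j U
  proof -
    have part: "partition_on (received D j) (tuples D j)" and cardU: "card U = k"
      and uniq: "\<And>i. i \<in> src v A j \<Longrightarrow> \<exists>!x. x \<in> U \<and> obj_node x = i"
      using legal j U unfolding legal_placement_def D by blast+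
    have Urec: "U \<subseteq> received D j" using part U unfolding partition_on_def by blast
    have finU: "finite U" using cardU lam_less by (metis card.infinite not_less_zero)
    have node: "obj_node x \<in> src v A j" "j \<in> obj_targets x" "A (obj_node x) j = 1" if "x \<in> U" for x
      using that Urec by (auto simp: received_def D all_objects_def src_def tgt_def)
    have "(of_nat (card (U \<inter> {x. flip x})) :: bit) = 0"
    proof (cases "U \<inter> {x. flip x} = {}")
      case False
      then obtain z where z: "z \<in> U" "flip z" by blast
      then have "j \<in> S (obj_node z)" "obj_node z \<in> F" using node(2) by (auto simp: flip_def)
      \<comment> \<open>An alive \<open>j\<close> differs from \<open>\<sigma> (obj_node z)\<close>,
        which lies in \<open>F\<close>; only a shared column remains.\<close>
      then have d: "col_count A F j = 2"
        using j(2) permutes_in_image[OF \<sigma>(1)] by (auto simp: S_def)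
      have inS: "j \<in> S (obj_node x)" if "x \<in> U" for x
        using that d j node(3) by (simp add: S_def)
      \<comment> \<open>Since \<open>z\<close> is flipped, alignment forces every replica in
        \<open>U\<close> from a node of \<open>F\<close> to be flipped as well; there are two of
        them.\<close>
      have flip_iff: "flip x \<longleftrightarrow> obj_node x \<in> F" if "x \<in> U" for x
        using aligned[rule_format, OF j(1) U z(1) that] inS z that by (auto simp: flip_def)
      have "bij_betw obj_node (U \<inter> {x. flip x}) (F \<inter> src v A j)"
        unfolding bij_betw_def
      proof
        show "inj_on obj_node (U \<inter> {x. flip x})"
          using uniq node(1) by (intro inj_onI) (metis IntD1)
        show "obj_node ` (U \<inter> {x. flip x}) = F \<inter> src v A j"
        proof
          show "F \<inter> src v A j \<subseteq> obj_node ` (U \<inter> {x. flip x})"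
            using uniq flip_iff by blast
        qed (use node(1) flip_iff in auto)
      qed
      then have "card (U \<inter> {x. flip x}) = 2"
        using bij_betw_same_card col_count_card[OF sub j(1)] d by metis
      then show ?thesis by simp
    qed simp
    then show ?thesis
      using finU by (simp add: parity_def D w_def w'_def sum_of_bool_eq)
  qed
  moreover have "valuation D w" "valuation D w'"
    by (simp_all add: valuation_def D w_def w'_def)
  moreover have "\<forall>x\<in>objects D. primary D x \<notin> F \<longrightarrow> w x = w' x"
    by (simp add: D w_def w'_def flip_def)
  moreover have "permits_recovery v D F"
    using univ legal sub unfolding universally_recoverable_def by blast
  ultimately have same: "w x = w' x" if "x \<in> objects D" "primary D x \<in> F" for x
    using that unfolding permits_recovery_def by blast
  obtain i where i: "i \<in> F" using F by blast
  \<comment> \<open>The bound on \<open>q\<close> gives a \<open>q\<close>-set inside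
    \<open>S i\<close>; the object with these targets is flipped, so the flip is not
    vacuous.\<close>
  obtain T where T: "T \<subseteq> S i" "card T = q" "finite T"
    using S(2)[OF i] q obtain_subset_with_card_n by metis
  obtain x where x: "obj_node x = i" "obj_targets x = T" using ex_object[OF T(3)] by blast
  have "x \<in> objects D" "flip x"
    using x T S(1)[OF i] i sub by (auto simp: D all_objects_def flip_def)
  then show False using same[of x] x i by (simp add: D w_def w'_def)
qed

lemma replica_threshold_eq:
  assumes "admits_private_target_permutation v A F" and "F \<noteq> {}"
    and "k \<ge> lam * (card F - 1) + 2"
  shows "replica_threshold v k A (card F) = lam * (card F - 1) + 2"
  unfolding replica_threshold_def
proof (rule Least_equality)
  show "lam * (card F - 1) + 2 \<le> k \<and> universally_recoverable v k A (card F) (lam * (card F - 1) + 2)"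
    using assms universally_recoverable_above by blast
  show "lam * (card F - 1) + 2 \<le> q" if "q \<le> k \<and> universally_recoverable v k A (card F) q" for q
    using not_universally_recoverable_below[OF assms(1,2), of q] that by linarith
qed

end

section \<open>The relabeled design\<close>

lemma card_bij_betw_Collect:
  assumes "bij_betw f X Y"
  shows "card {x \<in> X. Q (f x)} = card {y \<in> Y. Q y}"
proof (rule bij_betw_same_card)
  show "bij_betw f {x \<in> X. Q (f x)} {y \<in> Y. Q y}"
    using assms by (auto simp: bij_betw_def inj_on_def)
qed

lemma design_matrix_representative:
  assumes des: "sbibd P B inc v k lam" and rep: "representative P B inc v A"
  shows "design_matrix v k lam A"
proof -
  obtain pt bl where pt: "bij_betw pt {..<v} P" and bl: "bij_betw bl {..<v} B"
    and A: "\<And>i j. i < v \<Longrightarrow> j < v \<Longrightarrow> A i j = (if inc (pt i) (bl j) then 1 else 0)"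
    using rep unfolding representative_def by blast
  have ptP: "pt i \<in> P" if "i < v" for i using pt that by (auto dest: bij_betwE)
  have blB: "bl j \<in> B" if "j < v" for j using bl that by (auto dest: bij_betwE)
  have params: "1 \<le> lam" "lam < k" "k < v"
    and block: "\<And>b. b \<in> B \<Longrightarrow> card {x \<in> P. inc x b} = k"
    and point: "\<And>x. x \<in> P \<Longrightarrow> card {b \<in> B. inc x b} = k"
    and pair: "\<And>x y. x \<in> P \<Longrightarrow> y \<in> P \<Longrightarrow> x \<noteq> y \<Longrightarrow> card {b \<in> B. inc x b \<and> inc y b} = lam"
    using des unfolding sbibd_def by blast+
  show ?thesis
  proof
    show "1 \<le> lam" "lam < k" "k < v" by fact+
    show "A i j = 0 \<or> A i j = 1" if "i < v" "j < v" for i j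
      using A that by simp
    show "(\<Sum>t<v. A i t * A i' t) = (if i = i' then k else lam)" if i: "i < v" "i' < v" for i i'
    proof -
      have "(\<Sum>t<v. A i t * A i' t) = (\<Sum>t<v. if inc (pt i) (bl t) \<and> inc (pt i') (bl t) then 1 else 0)"
        using A i by (intro sum.cong) auto
      also have "\<dots> = card {t \<in> {..<v}. inc (pt i) (bl t) \<and> inc (pt i') (bl t)}"
        by (simp add: sum.If_cases Int_def)
      also have "\<dots> = card {b \<in> B. inc (pt i) b \<and> inc (pt i') b}"
        by (rule card_bij_betw_Collect[OF bl])
      also have "\<dots> = (if i = i' then k else lam)"
        using point[OF ptP] pair[OF ptP ptP] i bij_betw_imp_inj_on[OF pt]
        by (auto simp: inj_on_eq_iff)
      finally show ?thesis .
    qed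
    show "(\<Sum>i<v. A i t) = k" if t: "t < v" for t
    proof -
      have "(\<Sum>i<v. A i t) = (\<Sum>i<v. if inc (pt i) (bl t) then 1 else 0)"
        using A t by (intro sum.cong) auto
      also have "\<dots> = card {i \<in> {..<v}. inc (pt i) (bl t)}"
        by (simp add: sum.If_cases Int_def)
      also have "\<dots> = card {x \<in> P. inc x (bl t)}"
        by (rule card_bij_betw_Collect[OF pt])
      finally show ?thesis using block blB t by simp
    qed
  qed
qed

lemma representative_relabel_columns:
  assumes rep: "representative P B inc v A" and \<pi>: "\<pi> permutes {..<v}"
  shows "representative P B inc v (relabel_columns \<pi> A)"
proof -
  obtain pt bl where pt: "bij_betw pt {..<v} P" and bl: "bij_betw bl {..<v} B"
    and A: "\<forall>i<v. \<forall>j<v. A i j = (if inc (pt i) (bl j) then 1 else 0)"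
    using rep unfolding representative_def by blast
  have "\<pi> j < v" if "j < v" for j using permutes_in_image[OF \<pi>, of j] that by simp
  then have "\<forall>i<v. \<forall>j<v. relabel_columns \<pi> A i j = (if inc (pt i) ((bl \<circ> \<pi>) j) then 1 else 0)"
    using A by (simp add: relabel_columns_def)
  moreover have "bij_betw (bl \<circ> \<pi>) {..<v} B"
    using permutes_imp_bij[OF \<pi>] bl by (rule bij_betw_trans)
  ultimately show ?thesis using pt unfolding representative_def by blast
qed

theorem propositionV3:
  fixes P :: "'p set" and B :: "'b set" and inc :: "'p \<Rightarrow> 'b \<Rightarrow> bool"
    and v k lam p :: nat and A :: "nat \<Rightarrow> nat \<Rightarrow> nat" and F :: "nat set"
  assumes "p \<ge> 2"
    and "k \<ge> lam * (p - 1) + 2"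
    and "sbibd P B inc v k lam"
    and "representative P B inc v A"
    and "zero_diagonal v A"
    and "pairwise_separated v A F"
    and "card F = p"
  shows "\<exists>\<pi> A'. \<pi> permutes {..<v} \<and> A' = relabel_columns \<pi> A \<and>
           representative P B inc v A' \<and> zero_diagonal v A' \<and>
           admits_private_target_permutation v A' F \<and>
           replica_threshold v k A' p = lam * (p - 1) + 2"
proof -
  interpret design_matrix v k lam A
    using assms(3,4) by (rule design_matrix_representative)
  obtain \<pi> where \<pi>: "\<pi> permutes {..<v}" "zero_diagonal v (relabel_columns \<pi> A)"
    "admits_private_target_permutation v (relabel_columns \<pi> A) F"
    using ex_private_relabeling[OF assms(6)] assms(1,2,7) by auto
  have rep: "representative P B inc v (relabel_columns \<pi> A)"
    using assms(4) \<pi>(1) by (rule representative_relabel_columns)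
  \<comment> \<open>The threshold is computed for the relabeled matrix, an incidence matrix of the
    same design in which the private targets lie in \<open>F\<close>.\<close>
  interpret relabeled: design_matrix v k lam "relabel_columns \<pi> A"
    using assms(3) rep by (rule design_matrix_representative)
  have "F \<noteq> {}" using assms(1,7) by auto
  then have "replica_threshold v k (relabel_columns \<pi> A) p = lam * (p - 1) + 2"
    using relabeled.replica_threshold_eq[OF \<pi>(3)] assms(2,7) by simp
  then show ?thesis using \<pi> rep by blast
qed

end
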